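(* Let $\sigma$ be an s-finite kernel from a measurable space $S$ to a standard Borel space $T$. Then there exists a measurable partial function $d:S\times[0,\infty)\rightharpoonup T$ such that, for all $s\in S$, $$\sigma(s)=d(s,-)_*\big(\mathbb{U}_{[0,\infty)}\big).$$ Conversely, any kernel from $S$ to $T$ obtained in this way from a measurable partial function $d:S\times[0,\infty)\rightharpoonup T$ is s-finite.
   Context: A kernel from a measurable space $S$ to a measurable space $T$ is a map $\sigma:S\times\Sigma_T\to[0,\infty]$ that is measurable in its first argument and a measure in its second; $\sigma(s)$ denotes the measure $\sigma(s,-)$. It is finite if $\sup_{s}\sigma(s,T)<\infty$, and s-finite if it is a countable sum of finite kernels from $S$ to $T$. A measurable partial function $X\rightharpoonup Y$ is a measurable function $X\to Y+\{\bot\}$ (undefined where the value is $\bot$). The pushforward of a measure $m$ on $X$ along a measurable partial function $h:X\rightharpoonup Y$ is $(h_*m)(U)=m(\{x\mid h(x)\in U\})$ for $U\in\Sigma_Y$ (mass sent to $\bot$ is discarded). $\mathbb{U}_{[0,\infty)}$ is the Lebesgue measure on $[0,\infty)$. A standard Borel space is a set with the Borel $\sigma$-algebra of some complete separable metric. *)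

theory Defs
  imports "HOL-Analysis.Analysis"
begin

text \<open>A measurable space is represented by a measure whose measure component is ignored:
  only its \<^const>\<open>space\<close> and its \<^const>\<open>sets\<close> matter.\<close>

definition standard_borel :: "'a measure \<Rightarrow> bool" where
  "standard_borel T \<longleftrightarrow>
     (\<exists>m :: 'a metric. mspace m = space T \<and> mcomplete_of m \<and>
        separable_space (mtopology_of m) \<and>
        sets T = sigma_sets (space T) {U. openin (mtopology_of m) U})"

text \<open>Kernels are constrained on \<^term>\<open>space S\<close> only.\<close>

definition measure_kernel :: "'a measure \<Rightarrow> 'b measure \<Rightarrow> ('a \<Rightarrow> 'b measure) \<Rightarrow> bool" where
  "measure_kernel S T \<sigma> \<longleftrightarrow>
     (\<forall>s\<in>space S. sets (\<sigma> s) = sets T) \<and>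
     (\<forall>U\<in>sets T. (\<lambda>s. emeasure (\<sigma> s) U) \<in> borel_measurable S)"

definition finite_kernel :: "'a measure \<Rightarrow> 'b measure \<Rightarrow> ('a \<Rightarrow> 'b measure) \<Rightarrow> bool" where
  "finite_kernel S T \<sigma> \<longleftrightarrow>
     measure_kernel S T \<sigma> \<and> (SUP s\<in>space S. emeasure (\<sigma> s) (space T)) < \<infinity>"

text \<open>A finite sum of kernels is the special case in which all but finitely many of the
  \<^term>\<open>k i\<close> are zero.\<close>

definition s_finite_kernel :: "'a measure \<Rightarrow> 'b measure \<Rightarrow> ('a \<Rightarrow> 'b measure) \<Rightarrow> bool" where
  "s_finite_kernel S T \<sigma> \<longleftrightarrow>
     measure_kernel S T \<sigma> \<and>
     (\<exists>k :: nat \<Rightarrow> 'a \<Rightarrow> 'b measure.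
        (\<forall>i. finite_kernel S T (k i)) \<and>
        (\<forall>s\<in>space S. \<forall>U\<in>sets T. emeasure (\<sigma> s) U = (\<Sum>i. emeasure (k i s) U)))"

text \<open>The coproduct of a measurable space with the one-point space, \<^const>\<open>None\<close> being
  the additional point.\<close>

definition option_space :: "'a measure \<Rightarrow> 'a option measure" where
  "option_space M =
     sigma (insert None (Some ` space M))
       {B. B \<subseteq> insert None (Some ` space M) \<and> Some -` B \<in> sets M}"

abbreviation partial_measurable :: "'a measure \<Rightarrow> 'b measure \<Rightarrow> ('a \<Rightarrow> 'b option) set" where
  "partial_measurable X Y \<equiv> measurable X (option_space Y)"

definition pushforward_partial :: "'a measure \<Rightarrow> 'b measure \<Rightarrow> ('a \<Rightarrow> 'b option) \<Rightarrow> 'b measure" where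
  "pushforward_partial m Y h =
     measure_of (space Y) (sets Y) (\<lambda>U. emeasure m {x \<in> space m. h x \<in> Some ` U})"

definition lebesgue_nonneg :: "real measure" where
  "lebesgue_nonneg = restrict_space lborel {0..}"

lemma space_option_space [simp]: "space (option_space M) = insert None (Some ` space M)"
  unfolding option_space_def by (rule space_measure_of) auto

lemma sets_option_space:
  "sets (option_space M) =
     {B. B \<subseteq> insert None (Some ` space M) \<and> Some -` B \<in> sets M}"
proof -
  let ?O = "insert None (Some ` space M)"
  let ?A = "{B. B \<subseteq> ?O \<and> Some -` B \<in> sets M}"
  have "sigma_algebra ?O ?A"
    unfolding sigma_algebra_iff2
  proof (intro conjI ballI allI impI)
    fix B assume B: "B \<in> ?A"
    have "Some -` (?O - B) = space M - Some -` B" by auto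
    then show "?O - B \<in> ?A" using B by auto
  qed (auto simp: vimage_UN)
  then show ?thesis
    unfolding option_space_def
    by (subst sets_measure_of) (auto simp: sigma_algebra.sigma_sets_eq)
qed

lemma Some_image_in_sets_option_space: "U \<in> sets M \<Longrightarrow> Some ` U \<in> sets (option_space M)"
  using sets.sets_into_space[of U M]
  by (auto simp: sets_option_space inj_vimage_image_eq)

lemma space_pushforward_partial [simp]: "space (pushforward_partial m Y h) = space Y"
  unfolding pushforward_partial_def by (rule space_measure_of) (rule sets.space_closed)

lemma sets_pushforward_partial [simp]: "sets (pushforward_partial m Y h) = sets Y"
  unfolding pushforward_partial_def by simp

text \<open>For measurable \<^term>\<open>h\<close> the set function given to \<^const>\<open>measure_of\<close> is a measure,
  so \<^const>\<open>pushforward_partial\<close> has the intended values.\<close>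

lemma emeasure_pushforward_partial:
  assumes h: "h \<in> partial_measurable m Y" and U: "U \<in> sets Y"
  shows "emeasure (pushforward_partial m Y h) U = emeasure m {x \<in> space m. h x \<in> Some ` U}"
proof -
  let ?f = "\<lambda>U. {x \<in> space m. h x \<in> Some ` U}"
  have meas: "?f V \<in> sets m" if "V \<in> sets Y" for V
    using measurable_sets[OF h Some_image_in_sets_option_space[OF that]]
    by (simp add: vimage_def Int_def conj_commute)
  have "countably_additive (sets Y) (\<lambda>U. emeasure m (?f U))"
  proof (rule countably_additiveI)
    fix A :: "nat \<Rightarrow> _"
    assume A: "range A \<subseteq> sets Y" "disjoint_family A" "(\<Union>i. A i) \<in> sets Y"
    have "(\<Sum>i. emeasure m (?f (A i))) = emeasure m (\<Union>i. ?f (A i))"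
      using A meas by (intro suminf_emeasure) (auto simp: disjoint_family_on_def, blast)
    also have "(\<Union>i. ?f (A i)) = ?f (\<Union>i. A i)" by auto
    finally show "(\<Sum>i. emeasure m (?f (A i))) = emeasure m (?f (\<Union>i. A i))" .
  qed
  moreover have "positive (sets Y) (\<lambda>U. emeasure m (?f U))"
    by (simp add: positive_def)
  ultimately show ?thesis
    unfolding pushforward_partial_def
    by (intro emeasure_measure_of_sigma U sets.sigma_algebra_axioms)
qed

end

theory Submission
  imports Defs "HOL-Probability.Weak_Convergence"
begin

text \<open>A standard Borel space \<open>T\<close> has a measurable code \<open>f\<close> in the reals with a measurable partial
  left inverse \<open>g\<close>.  A finite kernel, transported along \<open>f\<close>, is the image of Lebesgue measure on
  the interval from 0 to its total mass under the quantile function of its distribution function,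
  which is jointly measurable; composing with \<open>g\<close> brings it back to \<open>T\<close>.  For an s-finite kernel
  the intervals of the finite summands are laid side by side in the half-line.  Conversely,
  cutting the half-line into unit intervals decomposes a pushforward into finite kernels.\<close>

section \<open>Measurability of partial functions\<close>

text \<open>Images under \<open>Some\<close> suffice as test sets: the preimage of
  \<open>None\<close> is the complement of the domain of definition, and that domain is the preimage
  of the image of \<open>space Y\<close>.\<close>

lemma partial_measurableI:
  assumes ran: "\<And>x. x \<in> space M \<Longrightarrow> h x \<in> insert None (Some ` space Y)"
    and pre: "\<And>U. U \<in> sets Y \<Longrightarrow> {x \<in> space M. h x \<in> Some ` U} \<in> sets M"
  shows "h \<in> partial_measurable M Y"
proof (rule measurableI)
  fix x assume "x \<in> space M"
  then show "h x \<in> space (option_space Y)" using ran by simp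
next
  fix B assume B: "B \<in> sets (option_space Y)"
  then have U: "Some -` B \<in> sets Y" by (simp add: sets_option_space)
  have "h -` B \<inter> space M = {x \<in> space M. h x \<in> Some ` (Some -` B)} \<union>
      (if None \<in> B then space M - {x \<in> space M. h x \<in> Some ` space Y} else {})"
    using ran B by (auto simp: sets_option_space image_iff)
  also have "\<dots> \<in> sets M" using pre[OF U] pre[OF sets.top] by auto
  finally show "h -` B \<inter> space M \<in> sets M" .
qed

text \<open>For a partial function the preimage of a complement is the domain minus the preimage,
  not the whole space minus it. The induction over \<open>sigma_sets\<close> therefore uses a
  measurable domain, which \<open>space Y \<in> G\<close> provides.\<close>

lemma partial_measurable_sigma_setsI:
  assumes ran: "\<And>x. x \<in> space M \<Longrightarrow> h x \<in> insert None (Some ` space Y)"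
    and gen: "sets Y = sigma_sets (space Y) G" "space Y \<in> G"
    and pre: "\<And>U. U \<in> G \<Longrightarrow> {x \<in> space M. h x \<in> Some ` U} \<in> sets M"
  shows "h \<in> partial_measurable M Y"
proof (rule partial_measurableI[OF ran])
  fix U assume "U \<in> sets Y"
  then have "U \<in> sigma_sets (space Y) G" using gen by simp
  then show "{x \<in> space M. h x \<in> Some ` U} \<in> sets M"
  proof induction
    case (Compl a)
    have "{x \<in> space M. h x \<in> Some ` (space Y - a)} =
        {x \<in> space M. h x \<in> Some ` space Y} - {x \<in> space M. h x \<in> Some ` a}"
      by auto
    then show ?case using Compl pre[OF gen(2)] by auto
  next
    case (Union a)
    have "{x \<in> space M. h x \<in> Some ` (\<Union>i. a i)} = (\<Union>i. {x \<in> space M. h x \<in> Some ` a i})"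
      by auto
    then show ?case using Union by auto
  qed (use pre in auto)
qed

lemma sets_partial_vimage:
  assumes "h \<in> partial_measurable M Y" "U \<in> sets Y"
  shows "{x \<in> space M. h x \<in> Some ` U} \<in> sets M"
  using measurable_sets[OF assms(1) Some_image_in_sets_option_space[OF assms(2)]]
  by (simp add: vimage_def Int_def conj_commute)

section \<open>Lebesgue measure on the half-line\<close>

lemma space_lebesgue_nonneg [simp]: "space lebesgue_nonneg = {0..}"
  by (simp add: lebesgue_nonneg_def space_restrict_space)

lemma sigma_finite_lebesgue_nonneg: "sigma_finite_measure lebesgue_nonneg"
  unfolding lebesgue_nonneg_def
  by (rule sigma_finite_measure_restrict_space[OF sigma_finite_lborel]) simp

lemma measurable_lebesgue_nonneg_borel: "(\<lambda>r. r) \<in> borel_measurable lebesgue_nonneg"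
  unfolding lebesgue_nonneg_def by (rule measurable_restrict_space1) simp

lemma emeasure_lebesgue_nonneg:
  assumes "A \<in> sets borel" "A \<subseteq> {0..}"
  shows "emeasure lebesgue_nonneg A = emeasure lborel A"
  unfolding lebesgue_nonneg_def using assms by (subst emeasure_restrict_space) auto

section \<open>Pushforwards of Lebesgue measure are s-finite\<close>

text \<open>A unit interval has Lebesgue measure 1, so the part of \<open>d\<close> over it gives a
  kernel of mass at most 1, uniformly in \<open>s\<close> as a finite kernel requires.\<close>

lemma s_finite_kernel_pushforward:
  assumes ker: "measure_kernel S T \<sigma>"
    and d: "d \<in> partial_measurable (S \<Otimes>\<^sub>M lebesgue_nonneg) T"
    and eq: "\<And>s. s \<in> space S \<Longrightarrow> \<sigma> s = pushforward_partial lebesgue_nonneg T (\<lambda>r. d (s, r))"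
  shows "s_finite_kernel S T \<sigma>"
proof -
  interpret L: sigma_finite_measure lebesgue_nonneg by (rule sigma_finite_lebesgue_nonneg)
  \<comment> \<open>Half-open intervals partition the half-line: the only index for \<open>r\<close>
    is \<open>nat \<lfloor>r\<rfloor>\<close>, which gives both disjointness and covering
    below.\<close>
  define I where "I i = {real i..<real (Suc i)}" for i
  \<comment> \<open>Outside the interval the value is \<open>None\<close>, whose mass a pushforward
    discards; each piece thus remains a pushforward of the same measure.\<close>
  define e where "e i x = (if snd x \<in> I i then d x else None)" for i and x :: "'a \<times> real"
  define k where "k i s = pushforward_partial lebesgue_nonneg T (\<lambda>r. e i (s, r))" for i s
  have [measurable]: "snd \<in> borel_measurable (S \<Otimes>\<^sub>M lebesgue_nonneg)"
    by (rule measurable_compose[OF measurable_snd measurable_lebesgue_nonneg_borel])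
  have preI: "{x \<in> space (S \<Otimes>\<^sub>M lebesgue_nonneg). snd x \<in> I i} \<in> sets (S \<Otimes>\<^sub>M lebesgue_nonneg)" for i
    unfolding I_def by measurable
  have e: "e i \<in> partial_measurable (S \<Otimes>\<^sub>M lebesgue_nonneg) T" for i
  proof (rule partial_measurableI)
    fix x assume "x \<in> space (S \<Otimes>\<^sub>M lebesgue_nonneg)"
    then show "e i x \<in> insert None (Some ` space T)"
      using measurable_space[OF d] by (simp add: e_def)
  next
    fix U assume U: "U \<in> sets T"
    have "{x \<in> space (S \<Otimes>\<^sub>M lebesgue_nonneg). e i x \<in> Some ` U} =
      {x \<in> space (S \<Otimes>\<^sub>M lebesgue_nonneg). snd x \<in> I i} \<inter>
      {x \<in> space (S \<Otimes>\<^sub>M lebesgue_nonneg). d x \<in> Some ` U}"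
      by (auto simp: e_def)
    then show "{x \<in> space (S \<Otimes>\<^sub>M lebesgue_nonneg). e i x \<in> Some ` U} \<in> sets (S \<Otimes>\<^sub>M lebesgue_nonneg)"
      using preI[of i] sets_partial_vimage[OF d U] by auto
  qed
  have sec: "(\<lambda>r. h (s, r)) \<in> partial_measurable lebesgue_nonneg T"
    if "s \<in> space S" "h \<in> partial_measurable (S \<Otimes>\<^sub>M lebesgue_nonneg) T" for s h
    using that by simp
  have k: "emeasure (k i s) U = emeasure lebesgue_nonneg {r \<in> {0..}. e i (s, r) \<in> Some ` U}"
    if "s \<in> space S" "U \<in> sets T" for i s U
    unfolding k_def using emeasure_pushforward_partial[OF sec[OF that(1) e] that(2)] by simp
  have "finite_kernel S T (k i)" for i
    unfolding finite_kernel_def measure_kernel_def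
  proof (intro conjI ballI)
    fix U assume U: "U \<in> sets T"
    let ?Q = "{x \<in> space (S \<Otimes>\<^sub>M lebesgue_nonneg). e i x \<in> Some ` U}"
    \<comment> \<open>Tonelli: as \<open>lebesgue_nonneg\<close> is sigma-finite, the measure of a
      section depends measurably on the point.\<close>
    have "(\<lambda>s. emeasure lebesgue_nonneg (Pair s -` ?Q)) \<in> borel_measurable S"
      by (rule L.measurable_emeasure_Pair[OF sets_partial_vimage[OF e U]])
    moreover have "emeasure lebesgue_nonneg (Pair s -` ?Q) = emeasure (k i s) U" if "s \<in> space S" for s
      unfolding k[OF that U] using that
      by (intro arg_cong[where f = "emeasure lebesgue_nonneg"]) (auto simp: space_pair_measure)
    ultimately show "(\<lambda>s. emeasure (k i s) U) \<in> borel_measurable S"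
      by (simp cong: measurable_cong)
  next
    have "emeasure (k i s) (space T) \<le> 1" if "s \<in> space S" for s
    proof -
      have "emeasure (k i s) (space T) \<le> emeasure lebesgue_nonneg (I i)"
        unfolding k[OF that sets.top]
        by (intro emeasure_mono)
          (auto simp: e_def I_def lebesgue_nonneg_def sets_restrict_space_iff split: if_splits)
      also have "\<dots> = 1"
        by (subst emeasure_lebesgue_nonneg) (auto simp: I_def)
      finally show ?thesis .
    qed
    then have "(SUP s\<in>space S. emeasure (k i s) (space T)) \<le> 1" by (rule SUP_least)
    then show "(SUP s\<in>space S. emeasure (k i s) (space T)) < \<infinity>"
      by (rule le_less_trans) simp
  qed (simp add: k_def)
  moreover have "emeasure (\<sigma> s) U = (\<Sum>i. emeasure (k i s) U)"
    if s: "s \<in> space S" and U: "U \<in> sets T" for s U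
  proof -
    let ?A = "\<lambda>i. {r \<in> {0..}. e i (s, r) \<in> Some ` U}"
    have "disjoint_family ?A"
    proof (unfold disjoint_family_on_def, intro ballI impI)
      fix i j :: nat assume ij: "i \<noteq> j"
      have "nat \<lfloor>r\<rfloor> = i" if "r \<in> ?A i" for r i
        using that by (auto simp: e_def I_def split: if_splits) linarith
      then show "?A i \<inter> ?A j = {}" using ij by blast
    qed
    moreover have "?A i \<in> sets lebesgue_nonneg" for i
      using sets_partial_vimage[OF sec[OF s e] U] by simp
    ultimately have "(\<Sum>i. emeasure (k i s) U) = emeasure lebesgue_nonneg (\<Union>i. ?A i)"
      unfolding k[OF s U] by (intro suminf_emeasure) auto
    also have "(\<Union>i. ?A i) = {r \<in> {0..}. d (s, r) \<in> Some ` U}"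
    proof (intro equalityI subsetI)
      fix r assume r: "r \<in> {r \<in> {0..}. d (s, r) \<in> Some ` U}"
      then have "r \<in> I (nat \<lfloor>r\<rfloor>)" by (auto simp: I_def) linarith
      then have "r \<in> ?A (nat \<lfloor>r\<rfloor>)" using r by (auto simp: e_def)
      then show "r \<in> (\<Union>i. ?A i)" by blast
    qed (auto simp: e_def split: if_splits)
    finally show ?thesis
      unfolding eq[OF s] using emeasure_pushforward_partial[OF sec[OF s d] U] by simp
  qed
  ultimately show ?thesis
    unfolding s_finite_kernel_def using ker by blast
qed

section \<open>Coding a standard Borel space in the reals\<close>

text \<open>With the digits restricted to 0 and 1, the tail of a ternary expansion is at most
  one half, so a digit can be read off by rounding down.\<close>

lemma ternary_digit:
  fixes b :: "nat \<Rightarrow> bool"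
  shows "\<lfloor>3 ^ k * (\<Sum>n. of_bool (b n) * (1/3) ^ n :: real)\<rfloor> mod 3 = (of_bool (b k) :: int)"
proof -
  let ?t = "\<lambda>n. of_bool (b n) * (1/3) ^ n :: real"
  \<comment> \<open>After scaling by \<open>3 ^ k\<close> the digits before place \<open>k\<close>
    contribute \<open>3 * u\<close>, which vanishes modulo 3; digit \<open>k\<close> lands in the
    units place, and the later digits form the fractional part \<open>v\<close>.\<close>
  define u where "u = (\<Sum>n<k. of_bool (b n) * 3 ^ (k - n - 1) :: int)"
  have bnd: "norm (?t n) \<le> (1/3) ^ n" for n by simp
  have summ: "summable ?t"
    by (rule summable_comparison_test'[OF summable_geometric[of "1/3 :: real"] bnd]) simp
  have summ': "summable (\<lambda>n. ?t (n + Suc k))" using summ by (subst summable_iff_shift)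
  have sg: "summable (\<lambda>n. (1/3) ^ (n + Suc k) :: real)"
    by (subst summable_iff_shift) (rule summable_geometric, simp)
  have "(\<Sum>n. (1/3) ^ (n + Suc k) :: real) = (1/3) ^ Suc k * (\<Sum>n. (1/3) ^ n)"
    by (subst suminf_mult[symmetric]) (auto simp: power_add mult_ac summable_geometric)
  also have "\<dots> = (1/3) ^ k / 2"
    by (subst suminf_geometric) (auto simp: field_simps)
  finally have geo: "(\<Sum>n. (1/3) ^ (n + Suc k) :: real) = (1/3) ^ k / 2" .
  define v where "v = 3 ^ k * (\<Sum>n. ?t (n + Suc k))"
  have "v \<le> 3 ^ k * (\<Sum>n. (1/3) ^ (n + Suc k))"
    unfolding v_def by (intro mult_left_mono suminf_le summ' sg) auto
  also have "\<dots> = 1/2" unfolding geo by (simp add: field_simps)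
  finally have v1: "v < 1" by simp
  have v0: "0 \<le> v" unfolding v_def by (intro mult_nonneg_nonneg suminf_nonneg summ') auto
  have "3 ^ k * (\<Sum>n<k. ?t n) = real_of_int (3 * u)"
    unfolding u_def sum_distrib_left of_int_sum
  proof (rule sum.cong)
    fix n assume "n \<in> {..<k}"
    then obtain j where "k = Suc (n + j)" by (auto dest: less_imp_Suc_add)
    then show "3 ^ k * ?t n = real_of_int (3 * (of_bool (b n) * 3 ^ (k - n - 1)))"
      by (simp add: power_add field_simps)
  qed simp
  then have "3 ^ k * suminf ?t = of_int (3 * u + of_bool (b k)) + v"
    unfolding v_def suminf_split_initial_segment[OF summ, of "Suc k"]
    by (simp add: algebra_simps power_one_over)
  then have "\<lfloor>3 ^ k * suminf ?t\<rfloor> = 3 * u + of_bool (b k)"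
    using v0 v1 by (intro floor_unique) auto
  then show ?thesis by simp
qed

text \<open>This carries measures on \<open>T\<close> to the reals, where distribution functions are
  available, and back. A point is determined by the balls around a dense sequence that contain it,
  which is countably much information and fits into one real.\<close>

lemma standard_borel_real_code:
  fixes T :: "'b measure"
  assumes T: "standard_borel T"
  obtains f g where "f \<in> borel_measurable T" "g \<in> partial_measurable borel T"
    "\<And>t. t \<in> space T \<Longrightarrow> g (f t :: real) = Some t"
proof (cases "space T = {}")
  \<comment> \<open>The empty space is split off because the enumeration of a dense set by
    \<open>from_nat_into\<close> presupposes a point; here the inverse law is vacuous.\<close>
  case True
  have "(\<lambda>_. None) \<in> partial_measurable borel T"
    by (rule partial_measurableI) auto
  moreover have "(\<lambda>_. 0 :: real) \<in> borel_measurable T" by simp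
  ultimately show thesis using that True by blast
next
  case False
  from T obtain m :: "'b metric" where m: "mspace m = space T" "mcomplete_of m"
      "separable_space (mtopology_of m)"
      "sets T = sigma_sets (space T) {U. openin (mtopology_of m) U}"
    unfolding standard_borel_def by blast
  define d where "d = mdist m"
  interpret Metric_space "space T" d
    unfolding d_def m(1)[symmetric] by (rule Metric_space_mspace_mdist)
  have mt: "mtopology_of m = mtopology" by (simp add: mtopology_of_def m(1) d_def)
  have complete: mcomplete using m(2) by (simp add: mcomplete_of_def m(1) d_def)
  have setsT: "sets T = sigma_sets (space T) {U. openin mtopology U}" using m(4) mt by simp
  have openT: "U \<in> sets T" if "openin mtopology U" for U
    unfolding setsT using that by (intro sigma_sets.Basic) simp
  obtain C where C: "countable C" "C \<subseteq> space T" "mtopology closure_of C = space T"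
    using m(3) unfolding mt separable_space_def by auto
  have "C \<noteq> {}" using C(3) False by auto
  define x where "x = from_nat_into C"
  have x: "x j \<in> space T" for j
    unfolding x_def using from_nat_into[OF \<open>C \<noteq> {}\<close>] C(2) by blast
  define \<delta> where "\<delta> n = 1 / real (Suc n)" for n
  have \<delta>_pos: "0 < \<delta> n" for n by (simp add: \<delta>_def)
  have \<delta>_lim: "\<delta> \<longlonglongrightarrow> 0" unfolding \<delta>_def using LIMSEQ_inverse_real_of_nat by (simp add: inverse_eq_divide)
  have near: "\<exists>j. t \<in> mball (x j) (\<delta> n)" if t: "t \<in> space T" for t n
  proof -
    have "t \<in> mtopology closure_of C" using t C(3) by simp
    then obtain y where "y \<in> C" "y \<in> mball t (\<delta> n)"
      unfolding metric_closure_of using \<delta>_pos by blast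
    moreover obtain j where "y = x j"
      using \<open>y \<in> C\<close> C(1) from_nat_into_surj unfolding x_def by metis
    ultimately show ?thesis using commute by (intro exI[of _ j]) auto
  qed
  \<comment> \<open>\<open>f t\<close> lists in its ternary digits which of the balls around the dense sequence contain \<open>t\<close>;
    \<open>g\<close> reads off one ball of each radius and returns the limit of the centres.  As \<open>g\<close> is
    defined wherever these centres form a fast Cauchy sequence, it is not needed that the range
    of \<open>f\<close> is a Borel set.\<close>
  define b where "b t k = (t \<in> mball (x (snd (prod_decode k))) (\<delta> (fst (prod_decode k))))" for t k
  define f where "f t = (\<Sum>k. of_bool (b t k) * (1/3) ^ k :: real)" for t
  define bit where "bit y k = (\<lfloor>3 ^ k * y\<rfloor> mod 3 = 1)" for y :: real and k :: nat
  have bit_f: "bit (f t) k = b t k" for t k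
    unfolding bit_def f_def ternary_digit by simp
  \<comment> \<open>If \<open>y\<close> marks no ball of radius \<open>\<delta> n\<close>, then
    \<open>LEAST\<close> yields an unspecified index. This does no harm, as \<open>P\<close> tests
    whichever centres are chosen.\<close>
  define J where "J n y = (LEAST j. bit y (prod_encode (n, j)))" for n y
  \<comment> \<open>Two balls of radii \<open>\<delta> n\<close> and \<open>\<delta> n'\<close> with
    a common point have centres closer than \<open>\<delta> n + \<delta> n'\<close>, so
    \<open>P\<close> holds at every code \<open>f t\<close>. It also forces the centres to be
    Cauchy, and it is a countable conjunction, hence measurable.\<close>
  define P where "P y \<longleftrightarrow> (\<forall>n n'. d (x (J n y)) (x (J n' y)) < \<delta> n + \<delta> n')" for y
  define l where "l y = (THE l. limitin mtopology (\<lambda>n. x (J n y)) l sequentially)" for y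
  define g where "g y = (if P y then Some (l y) else None)" for y
  have lim: "limitin mtopology (\<lambda>n. x (J n y)) (l y) sequentially" if "P y" for y
  proof -
    have "MCauchy (\<lambda>n. x (J n y))"
      unfolding MCauchy_def
    proof (intro conjI allI impI)
      fix e :: real assume "0 < e"
      then have "\<forall>\<^sub>F n in sequentially. \<delta> n < e / 2"
        by (intro order_tendstoD(2)[OF \<delta>_lim]) simp
      then obtain N where N: "\<And>n. N \<le> n \<Longrightarrow> \<delta> n < e / 2"
        unfolding eventually_sequentially by blast
      have "d (x (J n y)) (x (J n' y)) < e" if "N \<le> n" "N \<le> n'" for n n'
      proof -
        have "d (x (J n y)) (x (J n' y)) < \<delta> n + \<delta> n'" using \<open>P y\<close> unfolding P_def by blast
        then show ?thesis using N[OF that(1)] N[OF that(2)] by linarith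
      qed
      then show "\<exists>N. \<forall>n n'. N \<le> n \<longrightarrow> N \<le> n' \<longrightarrow> d (x (J n y)) (x (J n' y)) < e" by blast
    qed (use x in auto)
    then obtain z where z: "limitin mtopology (\<lambda>n. x (J n y)) z sequentially"
      using complete unfolding mcomplete_def by blast
    have "l y = z" unfolding l_def
      by (intro the_equality z) (use z limitin_metric_unique in force)
    then show ?thesis using z by simp
  qed
  have l_space: "l y \<in> space T" if "P y" for y
    using limitin_mspace[OF lim[OF that]] .
  have lim_dist: "\<forall>\<^sub>F n in sequentially. d (x (J n y)) (l y) < e" if "P y" "0 < e" for y e
    using lim[OF that(1)] that(2) unfolding limitin_metric by (auto elim: eventually_mono)
  have gf: "g (f t) = Some t" if t: "t \<in> space T" for t
  proof -
    \<comment> \<open>The balls marked by \<open>f t\<close> are those containing \<open>t\<close>,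
      and density provides one of each radius; hence the chosen centres approach
      \<open>t\<close>.\<close>
    have J: "d (x (J n (f t))) t < \<delta> n" for n
    proof -
      obtain j where "t \<in> mball (x j) (\<delta> n)" using near[OF t] by blast
      then have "bit (f t) (prod_encode (n, j))" unfolding bit_f b_def by simp
      then have "bit (f t) (prod_encode (n, J n (f t)))" unfolding J_def by (rule LeastI)
      then show ?thesis unfolding bit_f b_def by simp
    qed
    have P: "P (f t)" unfolding P_def
    proof (intro allI)
      fix n n'
      show "d (x (J n (f t))) (x (J n' (f t))) < \<delta> n + \<delta> n'"
        using triangle'[OF x t x, of "J n (f t)" "J n' (f t)"] J[of n] J[of n'] by linarith
    qed
    have "limitin mtopology (\<lambda>n. x (J n (f t))) t sequentially"
      unfolding limitin_metric
    proof (intro conjI t allI impI)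
      fix e :: real assume "0 < e"
      have "\<forall>\<^sub>F n in sequentially. \<delta> n < e" by (rule order_tendstoD(2)[OF \<delta>_lim \<open>0 < e\<close>])
      then show "\<forall>\<^sub>F n in sequentially. x (J n (f t)) \<in> space T \<and> d (x (J n (f t))) t < e"
        by eventually_elim (use J x less_trans in blast)
    qed
    then have "l (f t) = t"
      using lim[OF P] limitin_metric_unique by force
    then show ?thesis using P by (simp add: g_def)
  qed
  have f: "f \<in> borel_measurable T"
  proof -
    have [measurable]: "Measurable.pred T (\<lambda>t. b t k)" for k
    proof -
      have "{t \<in> space T. b t k} = mball (x (snd (prod_decode k))) (\<delta> (fst (prod_decode k)))"
        unfolding b_def by auto
      then show ?thesis using openT by (simp add: pred_def)
    qed
    show ?thesis unfolding f_def by measurable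
  qed
  have [measurable]: "Measurable.pred borel (\<lambda>y. bit y k)" for k
    unfolding bit_def by measurable
  have J[measurable]: "J n \<in> borel \<rightarrow>\<^sub>M count_space UNIV" for n
    unfolding J_def by measurable
  have [measurable]: "Measurable.pred borel P"
    unfolding P_def by measurable
  have g: "g \<in> partial_measurable borel T"
  proof (rule partial_measurable_sigma_setsI[OF _ setsT])
    fix U assume U: "U \<in> {U. openin mtopology U}"
    \<comment> \<open>For open \<open>U\<close>, membership of the limit is expressed by balls of
      one fixed radius around late centres. The right-hand side involves \<open>y\<close> only
      through the integer-valued \<open>J n y\<close> and countable quantifiers, so it is
      measurable.\<close>
    have "l y \<in> U \<longleftrightarrow> (\<exists>k N. \<forall>n\<ge>N. mball (x (J n y)) (\<delta> k) \<subseteq> U)" if y: "P y" for y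
    proof
      assume "l y \<in> U"
      then obtain r where r: "0 < r" "mball (l y) r \<subseteq> U" using U openin_mtopology by auto
      have "\<forall>\<^sub>F k in sequentially. \<delta> k < r / 2"
        using r(1) by (intro order_tendstoD(2)[OF \<delta>_lim]) simp
      then obtain k where k: "\<delta> k < r / 2" unfolding eventually_sequentially by blast
      have "\<forall>\<^sub>F n in sequentially. d (x (J n y)) (l y) < r / 2"
        by (rule lim_dist[OF y]) (simp add: r(1))
      then obtain N where N: "\<And>n. N \<le> n \<Longrightarrow> d (x (J n y)) (l y) < r / 2"
        unfolding eventually_sequentially by blast
      have "mball (x (J n y)) (\<delta> k) \<subseteq> U" if "N \<le> n" for n
      proof
        fix z assume "z \<in> mball (x (J n y)) (\<delta> k)"
        then have z: "z \<in> space T" "d (x (J n y)) z < \<delta> k" by auto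
        have "d (l y) z < r"
          using triangle[OF l_space[OF y] x z(1), of "J n y"] z(2) N[OF that] k
            commute[of "l y" "x (J n y)"] by linarith
        then show "z \<in> U" using r(2) z(1) l_space[OF y] by auto
      qed
      then show "\<exists>k N. \<forall>n\<ge>N. mball (x (J n y)) (\<delta> k) \<subseteq> U" by blast
    next
      assume "\<exists>k N. \<forall>n\<ge>N. mball (x (J n y)) (\<delta> k) \<subseteq> U"
      then obtain k N where N: "\<And>n. N \<le> n \<Longrightarrow> mball (x (J n y)) (\<delta> k) \<subseteq> U" by blast
      obtain N' where "\<And>n. N' \<le> n \<Longrightarrow> d (x (J n y)) (l y) < \<delta> k"
        using lim_dist[OF y \<delta>_pos] unfolding eventually_sequentially by blast
      then have "l y \<in> mball (x (J (max N N') y)) (\<delta> k)" using l_space[OF y] x by simp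
      then show "l y \<in> U" using N[of "max N N'"] by auto
    qed
    then have "{y \<in> space borel. g y \<in> Some ` U} =
        {y. P y \<and> (\<exists>k N. \<forall>n\<ge>N. mball (x (J n y)) (\<delta> k) \<subseteq> U)}"
      by (auto simp: g_def)
    also have "\<dots> \<in> sets borel"
    proof -
      have [measurable]: "Measurable.pred borel (\<lambda>y. mball (x (J n y)) (\<delta> k) \<subseteq> U)" for n k
        by (rule measurable_compose[OF J]) simp
      show ?thesis by measurable
    qed
    finally show "{y \<in> space borel. g y \<in> Some ` U} \<in> sets borel" .
  qed (use l_space in \<open>auto simp: g_def\<close>)
  show thesis by (rule that[OF f g gf])
qed

section \<open>Finite kernels through quantile functions\<close>

text \<open>This is inverse transform sampling with the parameter \<open>s\<close> carried along and
  total mass \<open>m s\<close> in place of 1. The bound on the domain of \<open>d\<close> is what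
  later allows different kernels to occupy disjoint intervals.\<close>

lemma finite_kernel_quantile:
  assumes T: "standard_borel T" and ker: "measure_kernel S T k"
    and fin: "\<And>s. s \<in> space S \<Longrightarrow> emeasure (k s) (space T) < \<infinity>"
  shows "\<exists>d \<in> partial_measurable (S \<Otimes>\<^sub>M (borel :: real measure)) T.
    (\<forall>s r. d (s, r) \<noteq> None \<longrightarrow> 0 < r \<and> r < measure (k s) (space T)) \<and>
    (\<forall>s\<in>space S. \<forall>U\<in>sets T. emeasure lborel {r. d (s, r) \<in> Some ` U} = emeasure (k s) U)"
proof -
  obtain f g where f: "f \<in> borel_measurable T" and g: "g \<in> partial_measurable borel T"
    and gf: "\<And>t. t \<in> space T \<Longrightarrow> g (f t :: real) = Some t"
    using standard_borel_real_code[OF T] by blast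
  have sets_k: "sets (k s) = sets T" if "s \<in> space S" for s
    using ker that by (simp add: measure_kernel_def)
  have space_k: "space (k s) = space T" if "s \<in> space S" for s
    using sets_eq_imp_space_eq[OF sets_k[OF that]] .
  have f_k: "f \<in> borel_measurable (k s)" if "s \<in> space S" for s
    using f measurable_cong_sets[OF sets_k[OF that] refl] by blast
  have meas_k: "(\<lambda>s. measure (k s) U) \<in> borel_measurable S" if "U \<in> sets T" for U
    using ker that unfolding measure_kernel_def measure_def
    by (intro borel_measurable_enn2real) blast
  define F where "F s y = measure (k s) {t \<in> space T. f t \<le> y}" for s y
  define m where "m s = measure (k s) (space T)" for s
  have [measurable]: "(\<lambda>s. F s y) \<in> borel_measurable S" for y
    unfolding F_def by (rule meas_k) (use f in measurable)
  have [measurable]: "m \<in> borel_measurable S"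
    unfolding m_def by (rule meas_k) simp
  define q where "q s r = Inf {y. r \<le> F s y}" for s r
  have cdf_F: "finite_borel_measure (distr (k s) borel f)" "cdf (distr (k s) borel f) = F s"
    "measure (distr (k s) borel f) UNIV = m s"
    if s: "s \<in> space S" for s
  proof -
    interpret K: finite_measure "k s"
      using fin[OF s] by (intro finite_measureI) (simp add: space_k[OF s])
    interpret D: finite_measure "distr (k s) borel f"
      by (rule K.finite_measure_distr[OF f_k[OF s]])
    show "finite_borel_measure (distr (k s) borel f)" by standard simp
    show "cdf (distr (k s) borel f) = F s"
      by (auto simp: cdf_def F_def fun_eq_iff measure_distr[OF f_k[OF s]] space_k[OF s]
          intro!: arg_cong[where f = "measure (k s)"])
    show "measure (distr (k s) borel f) UNIV = m s"
      by (simp add: measure_distr[OF f_k[OF s]] m_def space_k[OF s])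
  qed
  \<comment> \<open>Right continuity and the limits of \<open>F s\<close> make \<open>q s\<close>
    its lower adjoint on the open interval. The strict bounds matter: at \<open>r = 0\<close> the
    set under \<open>Inf\<close> is unbounded below, and at \<open>r = m s\<close> it may be
    empty.\<close>
  have q_le: "q s r \<le> y \<longleftrightarrow> r \<le> F s y" if s: "s \<in> space S" and r: "0 < r" "r < m s" for s r y
  proof -
    interpret D: finite_borel_measure "distr (k s) borel f" by (rule cdf_F(1)[OF s])
    interpret right_continuous_mono "F s" 0 "m s"
    proof
      show "continuous (at_right y) (F s)" for y
        using D.cdf_is_right_cont[of y] unfolding cdf_F(2)[OF s] .
      show "mono (F s)"
        using D.cdf_nondecreasing unfolding cdf_F(2)[OF s] by (intro monoI) blast
      show "(F s \<longlongrightarrow> 0) at_bot"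
        using D.cdf_lim_at_bot unfolding cdf_F(2)[OF s] .
      show "(F s \<longlongrightarrow> m s) at_top"
        using D.cdf_lim_at_top unfolding cdf_F(2)[OF s] D.borel_UNIV cdf_F(3)[OF s] .
    qed
    show ?thesis unfolding q_def by (rule pseudoinverse[OF r, symmetric])
  qed
  define p where "p x = (if 0 < snd x \<and> snd x < m (fst x) then q (fst x) (snd x) else 0)" for x
  have p[measurable]: "p \<in> borel_measurable (S \<Otimes>\<^sub>M borel)"
  proof (rule borel_measurable_iff_le[THEN iffD2, rule_format])
    fix y
    \<comment> \<open>The adjunction turns a sublevel set of \<open>p\<close> into a comparison of
      \<open>r\<close> with \<open>F s y\<close> for fixed \<open>y\<close>; measurability of
      \<open>F\<close> in \<open>s\<close> alone then yields joint measurability.\<close>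
    have "{x \<in> space (S \<Otimes>\<^sub>M borel). p x \<le> y} = {x \<in> space (S \<Otimes>\<^sub>M borel).
        if 0 < snd x \<and> snd x < m (fst x) then snd x \<le> F (fst x) y else 0 \<le> y}"
      using q_le by (auto simp: p_def space_pair_measure)
    also have "\<dots> \<in> sets (S \<Otimes>\<^sub>M borel)" by measurable
    finally show "{x \<in> space (S \<Otimes>\<^sub>M borel). p x \<le> y} \<in> sets (S \<Otimes>\<^sub>M borel)" .
  qed
  \<comment> \<open>Finite Borel measures on the reals with equal distribution functions coincide,
    so it suffices to measure the sublevel sets of the quantile function.\<close>
  have distr_p: "distr (restrict_space lborel {0<..<m s}) borel (\<lambda>r. p (s, r)) = distr (k s) borel f"
    (is "?I = ?D") if s: "s \<in> space S" for s
  proof (rule cdf_unique')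
    show "finite_borel_measure ?D" by (rule cdf_F(1)[OF s])
    interpret D: finite_borel_measure ?D by (rule cdf_F(1)[OF s])
    interpret R: finite_measure "restrict_space lborel {0<..<m s}"
    proof (rule finite_measureI)
      have "0 \<le> m s" by (simp add: m_def)
      then show "emeasure (restrict_space lborel {0<..<m s}) (space (restrict_space lborel {0<..<m s})) \<noteq> \<infinity>"
        by (simp add: space_restrict_space emeasure_restrict_space)
    qed
    have [measurable]: "(\<lambda>r. p (s, r)) \<in> borel_measurable borel"
      using s by simp
    have ps: "(\<lambda>r. p (s, r)) \<in> borel_measurable (restrict_space lborel {0<..<m s})"
      by (rule measurable_restrict_space1) simp
    interpret I: finite_measure ?I by (rule R.finite_measure_distr[OF ps])
    show "finite_borel_measure ?I" by standard simp
    show "cdf ?I = cdf ?D"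
    proof
      fix y
      have Fm: "0 \<le> F s y" "F s y \<le> m s"
        using D.cdf_nonneg[of y] D.cdf_bounded[of y] by (simp_all add: cdf_F[OF s])
      have "cdf ?I y = measure lborel {r. 0 < r \<and> r < m s \<and> p (s, r) \<le> y}"
        unfolding cdf_def measure_distr[OF ps atMost_borel]
        by (subst measure_restrict_space)
          (auto simp: space_restrict_space intro!: arg_cong[where f = "measure lborel"])
      also have "{r. 0 < r \<and> r < m s \<and> p (s, r) \<le> y} = {0<..<m s} \<inter> {0<..F s y}"
        using q_le[OF s] by (auto simp: p_def)
      also have "measure lborel \<dots> = F s y"
      \<comment> \<open>When \<open>F s y\<close> reaches the total mass, the open interval cuts off
        the endpoint \<open>m s\<close>, a null set; the length is \<open>F s y\<close> in both
        cases.\<close>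
      proof (cases "F s y = m s")
        case True
        then have "{0<..<m s} \<inter> {0<..F s y} = {0<..<m s}" by auto
        then show ?thesis using Fm True by simp
      next
        case False
        then have "{0<..<m s} \<inter> {0<..F s y} = {0<..F s y}" using Fm by auto
        then show ?thesis using Fm by simp
      qed
      finally show "cdf ?I y = cdf ?D y" by (simp add: cdf_F[OF s])
    qed
  qed
  \<comment> \<open>The default value 0 of \<open>p\<close> may lie in the domain of
    \<open>g\<close>; the value \<open>None\<close> outside the interval keeps it from contributing
    mass.\<close>
  define d where "d x = (if 0 < snd x \<and> snd x < m (fst x) then g (p x) else None)" for x
  have gU: "{y. g y \<in> Some ` U} \<in> sets borel" if "U \<in> sets T" for U
    using sets_partial_vimage[OF g that] by simp
  show ?thesis
  proof (intro bexI[of _ d] conjI allI impI ballI)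
    show "d \<in> partial_measurable (S \<Otimes>\<^sub>M borel) T"
    proof (rule partial_measurableI)
      fix x show "d x \<in> insert None (Some ` space T)"
        using measurable_space[OF g] by (simp add: d_def)
    next
      fix U assume "U \<in> sets T"
      note [measurable] = gU[OF this]
      have "{x \<in> space (S \<Otimes>\<^sub>M borel). d x \<in> Some ` U} = {x \<in> space (S \<Otimes>\<^sub>M borel).
          0 < snd x \<and> snd x < m (fst x) \<and> p x \<in> {y. g y \<in> Some ` U}}"
        by (auto simp: d_def)
      also have "\<dots> \<in> sets (S \<Otimes>\<^sub>M borel)" by measurable
      finally show "{x \<in> space (S \<Otimes>\<^sub>M borel). d x \<in> Some ` U} \<in> sets (S \<Otimes>\<^sub>M borel)" .
    qed
  next
    fix s r assume "d (s, r) \<noteq> None"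
    then show "0 < r" "r < measure (k s) (space T)"
      by (simp_all add: d_def m_def split: if_splits)
  next
    fix s U assume s: "s \<in> space S" and U: "U \<in> sets T"
    have [measurable]: "(\<lambda>r. p (s, r)) \<in> borel_measurable borel"
      using s by simp
    have ps: "(\<lambda>r. p (s, r)) \<in> borel_measurable (restrict_space lborel {0<..<m s})"
      by (rule measurable_restrict_space1) simp
    \<comment> \<open>Since \<open>g\<close> inverts \<open>f\<close> on \<open>space T\<close>,
      pulling \<open>U\<close> back along \<open>g\<close> and then along \<open>f\<close> returns
      \<open>U\<close>.\<close>
    have "emeasure (k s) U = emeasure (distr (k s) borel f) {y. g y \<in> Some ` U}"
      unfolding emeasure_distr[OF f_k[OF s] gU[OF U]] using gf sets.sets_into_space[OF U]
      by (intro arg_cong[where f = "emeasure (k s)"]) (auto simp: space_k[OF s])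
    also have "\<dots> = emeasure lborel {r. d (s, r) \<in> Some ` U}"
      unfolding distr_p[OF s, symmetric] emeasure_distr[OF ps gU[OF U]]
      by (subst emeasure_restrict_space)
        (auto simp: space_restrict_space d_def intro!: arg_cong[where f = "emeasure lborel"])
    finally show "emeasure lborel {r. d (s, r) \<in> Some ` U} = emeasure (k s) U" ..
  qed
qed

section \<open>Laying the summands out along the half-line\<close>

lemma emeasure_lborel_translate:
  fixes A :: "real set"
  assumes "A \<in> sets borel"
  shows "emeasure lborel {r. r - c \<in> A} = emeasure lborel A"
proof -
  have "emeasure lborel A = emeasure (distr lborel borel ((+) (- c))) A"
    by (simp add: lborel_distr_plus)
  also have "\<dots> = emeasure lborel {r. r - c \<in> A}"
    using assms by (subst emeasure_distr) (auto intro!: arg_cong[where f = "emeasure lborel"])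
  finally show ?thesis ..
qed

text \<open>Each finite summand has a mass bound \<open>c i\<close> uniform in \<open>s\<close>, so
  intervals of length \<open>c i\<close> at offsets independent of \<open>s\<close> have room for it
  at every \<open>s\<close> at once. Translation invariance and countable additivity then give the
  sum.\<close>

lemma s_finite_kernel_randomisation:
  assumes T: "standard_borel T" and sf: "s_finite_kernel S T \<sigma>"
  obtains d where "d \<in> partial_measurable (S \<Otimes>\<^sub>M lebesgue_nonneg) T"
    "\<And>s. s \<in> space S \<Longrightarrow> \<sigma> s = pushforward_partial lebesgue_nonneg T (\<lambda>r. d (s, r))"
proof -
  obtain k where fk: "\<And>i :: nat. finite_kernel S T (k i)"
    and sum: "\<And>s U. s \<in> space S \<Longrightarrow> U \<in> sets T \<Longrightarrow> emeasure (\<sigma> s) U = (\<Sum>i. emeasure (k i s) U)"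
    using sf unfolding s_finite_kernel_def by blast
  define c where "c i = enn2real (SUP s\<in>space S. emeasure (k i s) (space T))" for i
  have c: "emeasure (k i s) (space T) \<le> ennreal (c i)" if "s \<in> space S" for i s
    using SUP_upper[OF that, of "\<lambda>s. emeasure (k i s) (space T)"] fk[of i]
    by (simp add: c_def finite_kernel_def)
  have c0: "0 \<le> c i" for i by (simp add: c_def)
  define Q where "Q i d \<longleftrightarrow> d \<in> partial_measurable (S \<Otimes>\<^sub>M (borel :: real measure)) T \<and>
    (\<forall>s\<in>space S. \<forall>r. d (s, r) \<noteq> None \<longrightarrow> 0 < r \<and> r < c i) \<and>
    (\<forall>s\<in>space S. \<forall>U\<in>sets T. emeasure lborel {r. d (s, r) \<in> Some ` U} = emeasure (k i s) U)" for i d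
  have "\<exists>d. Q i d" for i
  proof -
    have ker: "measure_kernel S T (k i)" using fk[of i] by (simp add: finite_kernel_def)
    have "emeasure (k i s) (space T) < \<infinity>" if "s \<in> space S" for s
      using le_less_trans[OF c[OF that, of i]] by simp
    then obtain d where d: "d \<in> partial_measurable (S \<Otimes>\<^sub>M (borel :: real measure)) T"
      "\<And>s r. d (s, r) \<noteq> None \<Longrightarrow> 0 < r \<and> r < measure (k i s) (space T)"
      "\<And>s U. s \<in> space S \<Longrightarrow> U \<in> sets T \<Longrightarrow>
        emeasure lborel {r. d (s, r) \<in> Some ` U} = emeasure (k i s) U"
      using finite_kernel_quantile[OF T ker] by blast
    have "measure (k i s) (space T) \<le> c i" if "s \<in> space S" for s
      unfolding measure_def by (rule enn2real_leI[OF c0 c[OF that]])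
    then have "0 < r \<and> r < c i" if "s \<in> space S" "d (s, r) \<noteq> None" for s r
      using d(2)[OF that(2)] less_le_trans that(1) by blast
    then show ?thesis using d(1,3) unfolding Q_def by (intro exI[of _ d]) blast
  qed
  then obtain D where "\<And>i. Q i (D i)" by metis
  then have D: "\<And>i. D i \<in> partial_measurable (S \<Otimes>\<^sub>M (borel :: real measure)) T"
    "\<And>i s r. s \<in> space S \<Longrightarrow> D i (s, r) \<noteq> None \<Longrightarrow> 0 < r \<and> r < c i"
    "\<And>i s U. s \<in> space S \<Longrightarrow> U \<in> sets T \<Longrightarrow>
      emeasure lborel {r. D i (s, r) \<in> Some ` U} = emeasure (k i s) U"
    unfolding Q_def by blast+
  \<comment> \<open>The kernels \<open>k i\<close> are placed side by side: \<open>k i\<close> is realised on \<open>]a i, a i + c i[\<close>.\<close>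
  define a where "a i = (\<Sum>j<i. c j)" for i
  define E where "E i x = D i (fst x, snd x - a i)" for i x
  have a0: "0 \<le> a i" for i unfolding a_def using c0 by (simp add: sum_nonneg)
  have a_le: "a i + c i \<le> a j" if "i < j" for i j
  proof -
    have "a i + c i = a (Suc i)" by (simp add: a_def)
    also have "\<dots> \<le> a j" unfolding a_def using that c0 by (intro sum_mono2) auto
    finally show ?thesis .
  qed
  have E_range: "a i < r \<and> r < a i + c i" if "s \<in> space S" "E i (s, r) \<noteq> None" for i s r
    using D(2)[of s i "r - a i"] that by (auto simp: E_def)
  have E_unique: "i = j" if "s \<in> space S" "E i (s, r) \<noteq> None" "E j (s, r) \<noteq> None" for i j s r
    using E_range[OF that(1,2)] E_range[OF that(1,3)] a_le[of i j] a_le[of j i]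
    by (cases i j rule: linorder_cases) auto
  have E: "E i \<in> partial_measurable (S \<Otimes>\<^sub>M borel) T" for i
    unfolding E_def by (rule measurable_compose[OF _ D(1)]) measurable
  \<comment> \<open>For \<open>s\<close> in \<open>space S\<close> at most one \<open>E i\<close> is
    defined at \<open>(s, r)\<close>, so \<open>SOME\<close> makes no real choice; measurability
    follows from the countable union over \<open>i\<close>.\<close>
  define d where "d x = (if \<exists>i. E i x \<noteq> None then E (SOME i. E i x \<noteq> None) x else None)" for x
  have d_iff: "d (s, r) \<in> Some ` U \<longleftrightarrow> (\<exists>i. E i (s, r) \<in> Some ` U)" if s: "s \<in> space S" for s r U
  proof (cases "\<exists>i. E i (s, r) \<noteq> None")
    case True
    define j where "j = (SOME i. E i (s, r) \<noteq> None)"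
    have j: "E j (s, r) \<noteq> None" unfolding j_def using True by (rule someI_ex)
    have "d (s, r) = E j (s, r)" using True by (simp add: d_def j_def)
    moreover have "i = j" if "E i (s, r) \<in> Some ` U" for i
      by (rule E_unique[OF s _ j]) (use that in auto)
    ultimately show ?thesis by auto
  qed (auto simp: d_def)
  have d: "d \<in> partial_measurable (S \<Otimes>\<^sub>M borel) T"
  proof (rule partial_measurableI)
    fix x assume "x \<in> space (S \<Otimes>\<^sub>M (borel :: real measure))"
    then show "d x \<in> insert None (Some ` space T)"
      using measurable_space[OF E] by (simp add: d_def)
  next
    fix U assume U: "U \<in> sets T"
    have "d x \<in> Some ` U \<longleftrightarrow> (\<exists>i. E i x \<in> Some ` U)"
      if "x \<in> space (S \<Otimes>\<^sub>M (borel :: real measure))" for x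
      using that d_iff[of "fst x" "snd x"] by (simp add: space_pair_measure mem_Times_iff)
    then have "{x \<in> space (S \<Otimes>\<^sub>M borel). d x \<in> Some ` U} =
        (\<Union>i. {x \<in> space (S \<Otimes>\<^sub>M borel). E i x \<in> Some ` U})"
      by blast
    also have "\<dots> \<in> sets (S \<Otimes>\<^sub>M borel)" using sets_partial_vimage[OF E U] by auto
    finally show "{x \<in> space (S \<Otimes>\<^sub>M borel). d x \<in> Some ` U} \<in> sets (S \<Otimes>\<^sub>M borel)" .
  qed
  have "(\<lambda>x. (fst x, snd x)) \<in> S \<Otimes>\<^sub>M lebesgue_nonneg \<rightarrow>\<^sub>M S \<Otimes>\<^sub>M borel"
    by (intro measurable_Pair measurable_fst measurable_compose[OF measurable_snd measurable_lebesgue_nonneg_borel])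
  from measurable_compose[OF this d]
  have dL: "d \<in> partial_measurable (S \<Otimes>\<^sub>M lebesgue_nonneg) T" by simp
  show thesis
  proof (rule that[OF dL])
    fix s assume s: "s \<in> space S"
    show "\<sigma> s = pushforward_partial lebesgue_nonneg T (\<lambda>r. d (s, r))"
    proof (rule measure_eqI)
      show "sets (\<sigma> s) = sets (pushforward_partial lebesgue_nonneg T (\<lambda>r. d (s, r)))"
        using sf s by (simp add: s_finite_kernel_def measure_kernel_def)
      fix U assume "U \<in> sets (\<sigma> s)"
      then have U: "U \<in> sets T" using sf s by (simp add: s_finite_kernel_def measure_kernel_def)
      let ?A = "\<lambda>i. {r. E i (s, r) \<in> Some ` U}"
      have A: "?A i \<in> sets borel" for i
        using sets_partial_vimage[OF _ U, of "\<lambda>r. E i (s, r)" borel] E s by simp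
      have D': "{r. D i (s, r) \<in> Some ` U} \<in> sets borel" for i
        using sets_partial_vimage[OF _ U, of "\<lambda>r. D i (s, r)" borel] D(1) s by simp
      have "emeasure lborel (?A i) = emeasure (k i s) U" for i
        using emeasure_lborel_translate[OF D', of "a i" i] D(3)[OF s U, of i]
        by (simp add: E_def)
      then have "emeasure (\<sigma> s) U = (\<Sum>i. emeasure lborel (?A i))"
        using sum[OF s U] by simp
      also have "\<dots> = emeasure lborel (\<Union>i. ?A i)"
        using A E_unique[OF s]
        by (intro suminf_emeasure) (fastforce simp: disjoint_family_on_def)+
      \<comment> \<open>\<open>E i\<close> is defined only to the right of \<open>a i\<close>, and
        \<open>a i\<close> is nonnegative, so passing from the line to the half-line loses no
        mass.\<close>
      also have A_Union: "(\<Union>i. ?A i) = {r \<in> {0..}. d (s, r) \<in> Some ` U}"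
      proof -
        have "0 \<le> r" if "E i (s, r) \<in> Some ` U" for i r
          using E_range[OF s, of i r] a0[of i] that by auto
        then show ?thesis unfolding d_iff[OF s] by blast
      qed
      also have "emeasure lborel \<dots> = emeasure lebesgue_nonneg \<dots>"
      proof (rule emeasure_lebesgue_nonneg[symmetric])
        show "{r \<in> {0..}. d (s, r) \<in> Some ` U} \<in> sets borel"
          unfolding A_Union[symmetric] using A by blast
      qed auto
      also have "\<dots> = emeasure (pushforward_partial lebesgue_nonneg T (\<lambda>r. d (s, r))) U"
        using emeasure_pushforward_partial[OF _ U, of "\<lambda>r. d (s, r)" lebesgue_nonneg] dL s by simp
      finally show "emeasure (\<sigma> s) U = emeasure (pushforward_partial lebesgue_nonneg T (\<lambda>r. d (s, r))) U" .
    qed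
  qed
qed

theorem theorem15:
  fixes S :: "'a measure" and T :: "'b measure"
  assumes "standard_borel T"
  shows "(\<forall>\<sigma>. s_finite_kernel S T \<sigma> \<longrightarrow>
            (\<exists>d \<in> partial_measurable (S \<Otimes>\<^sub>M lebesgue_nonneg) T.
               \<forall>s\<in>space S. \<sigma> s = pushforward_partial lebesgue_nonneg T (\<lambda>r. d (s, r)))) \<and>
         (\<forall>\<sigma>. measure_kernel S T \<sigma> \<longrightarrow>
            (\<exists>d \<in> partial_measurable (S \<Otimes>\<^sub>M lebesgue_nonneg) T.
               \<forall>s\<in>space S. \<sigma> s = pushforward_partial lebesgue_nonneg T (\<lambda>r. d (s, r))) \<longrightarrow>
            s_finite_kernel S T \<sigma>)"
proof (intro conjI allI impI)
  fix \<sigma> :: "'a \<Rightarrow> 'b measure" assume "s_finite_kernel S T \<sigma>"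
  then obtain d where "d \<in> partial_measurable (S \<Otimes>\<^sub>M lebesgue_nonneg) T"
    "\<And>s. s \<in> space S \<Longrightarrow> \<sigma> s = pushforward_partial lebesgue_nonneg T (\<lambda>r. d (s, r))"
    using s_finite_kernel_randomisation[OF assms] by metis
  then show "\<exists>d \<in> partial_measurable (S \<Otimes>\<^sub>M lebesgue_nonneg) T.
      \<forall>s\<in>space S. \<sigma> s = pushforward_partial lebesgue_nonneg T (\<lambda>r. d (s, r))"
    by (intro bexI[of _ d]) blast+
next
  fix \<sigma> :: "'a \<Rightarrow> 'b measure" assume "measure_kernel S T \<sigma>"
    and "\<exists>d \<in> partial_measurable (S \<Otimes>\<^sub>M lebesgue_nonneg) T.
      \<forall>s\<in>space S. \<sigma> s = pushforward_partial lebesgue_nonneg T (\<lambda>r. d (s, r))"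
  then show "s_finite_kernel S T \<sigma>" using s_finite_kernel_pushforward by blast
qed

end
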